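(* Let $R$ be a noetherian integral domain with field of fractions $K\neq R$, let $A$ be a finite-dimensional $K$-algebra, let $\Lambda$ be an $R$-order in $A$, let $\mathrm{J}(A)$ be the Jacobson radical of $A$ and $h:A\to\overline{A}:=A/\mathrm{J}(A)$ the canonical projection, writing $\overline{a}=h(a)$ and $\overline{S}=h(S)$. Let $X$ be a full $\Lambda$-lattice in $A$. Then $\overline{X}$ is a full $\overline{\Lambda}$-lattice in $\overline{A}$. Moreover, for $\alpha\in X$: (a) if $X=\Lambda\alpha$ then $\overline{X}=\overline{\Lambda}\,\overline{\alpha}$; (b) if $\overline{X}=\overline{\Lambda}\,\overline{\alpha}$, then either $X=\Lambda\alpha$ or $X\neq\Lambda\beta$ for all $\beta\in X$.
   Context: An $R$-order in $A$ is a subring of $A$ (with the same unity) which is a finitely generated $R$-submodule containing a $K$-basis of $A$. A $\Lambda$-lattice is a left $\Lambda$-module finitely generated and torsion-free over $R$; a $\Lambda$-lattice $X\subseteq A$ is full if $KX=A$. *)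

theory Defs
  imports "HOL-Algebra.Algebra"
begin

section \<open>A domain inside its field of fractions\<close>

text \<open>The domain \<open>R\<close> is identified with its image in its field of fractions \<open>K\<close>, so it is
  given as a subset of the carrier of \<open>K\<close>.\<close>

locale noetherian_with_fractions =
  fixes R :: "'k set" and K :: "('k, 'm) ring_scheme" (structure)
  assumes field_K: "field K"
    and subring_R: "subring R K"
    and noetherian_R: "noetherian_domain (K\<lparr>carrier := R\<rparr>)"
    and fractions: "k \<in> carrier K \<Longrightarrow> \<exists>a\<in>R. \<exists>b\<in>R - {\<zero>}. k = a \<otimes> inv b"

section \<open>Linear combinations and bases\<close>

definition lin_span :: "'k set \<Rightarrow> ('k, 'a, 'n) module_scheme \<Rightarrow> 'a set \<Rightarrow> 'a set" where
  "lin_span R M S =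
    {(\<Oplus>\<^bsub>M\<^esub>s\<in>F. c s \<odot>\<^bsub>M\<^esub> s) | F c. finite F \<and> F \<subseteq> S \<and> c \<in> F \<rightarrow> R}"

definition lin_indep :: "('k, 'm) ring_scheme \<Rightarrow> ('k, 'a, 'n) module_scheme \<Rightarrow> 'a set \<Rightarrow> bool" where
  "lin_indep K M S \<longleftrightarrow>
    (\<forall>F c. finite F \<and> F \<subseteq> S \<and> c \<in> F \<rightarrow> carrier K \<and> (\<Oplus>\<^bsub>M\<^esub>s\<in>F. c s \<odot>\<^bsub>M\<^esub> s) = \<zero>\<^bsub>M\<^esub>
      \<longrightarrow> (\<forall>s\<in>F. c s = \<zero>\<^bsub>K\<^esub>))"

definition is_basis :: "('k, 'm) ring_scheme \<Rightarrow> ('k, 'a, 'n) module_scheme \<Rightarrow> 'a set \<Rightarrow> bool" where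
  "is_basis K M B \<longleftrightarrow>
    B \<subseteq> carrier M \<and> lin_indep K M B \<and> lin_span (carrier K) M B = carrier M"

section \<open>Finite-dimensional algebras\<close>

text \<open>The library's \<^locale>\<open>algebra\<close> is commutative; here the algebra is only required to be
  associative and unital (the zero algebra is allowed).\<close>

locale fd_algebra =
  fixes K :: "('k, 'm) ring_scheme" and A :: "('k, 'a, 'n) module_scheme"
  assumes field_K: "field K"
    and ring_A: "ring A"
    and module_A: "module K A"
    and smult_mult_left: "\<lbrakk>k \<in> carrier K; x \<in> carrier A; y \<in> carrier A\<rbrakk> \<Longrightarrow>
      (k \<odot>\<^bsub>A\<^esub> x) \<otimes>\<^bsub>A\<^esub> y = k \<odot>\<^bsub>A\<^esub> (x \<otimes>\<^bsub>A\<^esub> y)"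
    and smult_mult_right: "\<lbrakk>k \<in> carrier K; x \<in> carrier A; y \<in> carrier A\<rbrakk> \<Longrightarrow>
      x \<otimes>\<^bsub>A\<^esub> (k \<odot>\<^bsub>A\<^esub> y) = k \<odot>\<^bsub>A\<^esub> (x \<otimes>\<^bsub>A\<^esub> y)"
    and finite_dim: "\<exists>B. finite B \<and> is_basis K A B"

section \<open>Orders and lattices\<close>

locale algebra_order = fd_algebra K A
  for R :: "'k set" and K :: "('k, 'm) ring_scheme" and A :: "('k, 'a, 'n) module_scheme" +
  fixes L :: "'a set"
  assumes subring_L: "subring L A"
    and finitely_generated_L: "\<exists>S. finite S \<and> S \<subseteq> L \<and> L = lin_span R A S"
    and contains_basis: "\<exists>B \<subseteq> L. is_basis K A B"

text \<open>A lattice over the order \<open>L\<close> lying in \<open>A\<close>: its module structure is the restriction of the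
  left multiplication of \<open>A\<close>. (Torsion-freeness is automatic for a subset of a vector space
  over \<open>K\<close>; it is kept because it is part of the notion.)\<close>

locale lattice_in_algebra = algebra_order R K A L
  for R :: "'k set" and K :: "('k, 'm) ring_scheme" and A :: "('k, 'a, 'n) module_scheme"
    and L :: "'a set" +
  fixes M :: "'a set"
  assumes additive_M: "additive_subgroup M A"
    and left_closed_M: "\<lbrakk>l \<in> L; x \<in> M\<rbrakk> \<Longrightarrow> l \<otimes>\<^bsub>A\<^esub> x \<in> M"
    and finitely_generated_M: "\<exists>S. finite S \<and> S \<subseteq> M \<and> M = lin_span R A S"
    and torsion_free_M: "\<lbrakk>r \<in> R; x \<in> M; r \<odot>\<^bsub>A\<^esub> x = \<zero>\<^bsub>A\<^esub>\<rbrakk> \<Longrightarrow> r = \<zero>\<^bsub>K\<^esub> \<or> x = \<zero>\<^bsub>A\<^esub>"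

locale full_lattice_in_algebra = lattice_in_algebra +
  assumes full_M: "lin_span (carrier K) A M = carrier A"

definition left_multiples :: "('a, 'n) ring_scheme \<Rightarrow> 'a set \<Rightarrow> 'a \<Rightarrow> 'a set" where
  "left_multiples A L a = {l \<otimes>\<^bsub>A\<^esub> a | l. l \<in> L}"

section \<open>The Jacobson radical and its quotient\<close>

definition left_ideal :: "'a set \<Rightarrow> ('a, 'n) ring_scheme \<Rightarrow> bool" where
  "left_ideal I A \<longleftrightarrow>
    additive_subgroup I A \<and> (\<forall>a\<in>carrier A. \<forall>x\<in>I. a \<otimes>\<^bsub>A\<^esub> x \<in> I)"

definition maximal_left_ideal :: "'a set \<Rightarrow> ('a, 'n) ring_scheme \<Rightarrow> bool" where
  "maximal_left_ideal I A \<longleftrightarrow>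
    left_ideal I A \<and> I \<noteq> carrier A \<and>
    (\<forall>J. left_ideal J A \<and> I \<subseteq> J \<longrightarrow> J = I \<or> J = carrier A)"

text \<open>Intersecting with the carrier makes the radical of the zero ring the whole ring.\<close>

definition jacobson_radical :: "('a, 'n) ring_scheme \<Rightarrow> 'a set" where
  "jacobson_radical A = carrier A \<inter> \<Inter>{I. maximal_left_ideal I A}"

text \<open>\<^const>\<open>FactRing\<close> with the induced scalar multiplication \<open>k (I + x) = I + k x\<close>, written as a
  union over representatives in the style of \<^const>\<open>rcoset_mult\<close>.\<close>

definition quotient_algebra ::
  "('k, 'a, 'n) module_scheme \<Rightarrow> 'a set \<Rightarrow> ('k, 'a set) module" where
  "quotient_algebra A I =
    ring.extend (A Quot I) (module.fields (\<lambda>k C. \<Union>x\<in>C. I +>\<^bsub>A\<^esub> (k \<odot>\<^bsub>A\<^esub> x)))"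

definition radical_quotient :: "('k, 'a, 'n) module_scheme \<Rightarrow> ('k, 'a set) module" where
  "radical_quotient A = quotient_algebra A (jacobson_radical A)"

definition radical_proj :: "('k, 'a, 'n) module_scheme \<Rightarrow> 'a \<Rightarrow> 'a set" where
  "radical_proj A a = jacobson_radical A +>\<^bsub>A\<^esub> a"

end

theory Submission
  imports Defs
begin

text \<open>A lattice passes to the quotient because the projection commutes with linear spans. For the
  converse direction (b), suppose \<open>M = L\<beta>\<close> and let \<open>L\<alpha>\<close> and \<open>M\<close> have the same image. Then \<open>\<beta>\<close> is
  a unit of \<open>A\<close>, since \<open>M\<close> spans \<open>A\<close>. Write \<open>\<alpha> = l\<beta>\<close> and \<open>\<beta> \<equiv> m\<alpha>\<close> modulo the radical with
  \<open>l, m \<in> L\<close>. Cancelling \<open>\<beta>\<close> shows that \<open>n = 1 - ml\<close> lies in \<open>L\<close> and in the radical. Hence \<open>n\<close> is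
  nilpotent and \<open>ml = 1 - n\<close> has the inverse \<open>1 + n + n\<^sup>2 + \<dots>\<close> in \<open>L\<close>, so \<open>\<beta> \<in> L\<alpha>\<close>.\<close>

section \<open>Linear spans\<close>

lemma (in module) lin_spanI:
  assumes "finite F" "F \<subseteq> S" "c \<in> F \<rightarrow> C" "x = (\<Oplus>\<^bsub>M\<^esub>s\<in>F. c s \<odot>\<^bsub>M\<^esub> s)"
  shows "x \<in> lin_span C M S"
  using assms unfolding lin_span_def by blast

lemma (in module) lin_span_add:
  assumes "subring C R" "S \<subseteq> carrier M" "x \<in> lin_span C M S" "y \<in> lin_span C M S"
  shows "x \<oplus>\<^bsub>M\<^esub> y \<in> lin_span C M S"
proof -
  note C = subringE[OF assms(1)]
  obtain F c where F: "finite F" "F \<subseteq> S" "c \<in> F \<rightarrow> C" "x = (\<Oplus>\<^bsub>M\<^esub>s\<in>F. c s \<odot>\<^bsub>M\<^esub> s)"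
    using assms(3) unfolding lin_span_def by blast
  obtain G d where G: "finite G" "G \<subseteq> S" "d \<in> G \<rightarrow> C" "y = (\<Oplus>\<^bsub>M\<^esub>s\<in>G. d s \<odot>\<^bsub>M\<^esub> s)"
    using assms(4) unfolding lin_span_def by blast
  \<comment> \<open>The two combinations run over different finite sets. Padding both with zero
    coefficients to \<open>F \<union> G\<close> allows them to be added coefficient by
    coefficient.\<close>
  have ext: "(\<Oplus>\<^bsub>M\<^esub>s\<in>H. e s \<odot>\<^bsub>M\<^esub> s) =
      (\<Oplus>\<^bsub>M\<^esub>s\<in>F \<union> G. (if s \<in> H then e s else \<zero>) \<odot>\<^bsub>M\<^esub> s)"
    if "H \<subseteq> F \<union> G" "e \<in> H \<rightarrow> C" for H e
    using that F G C(1) assms(2)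
    by (intro M.add.finprod_mono_neutral_cong_left) (auto simp: Pi_iff subset_iff)
  let ?c = "\<lambda>s. if s \<in> F then c s else \<zero>" and ?d = "\<lambda>s. if s \<in> G then d s else \<zero>"
  have cd: "?c \<in> F \<union> G \<rightarrow> C" "?d \<in> F \<union> G \<rightarrow> C"
    using F(3) G(3) C(2) by auto
  have mem: "s \<in> carrier M" "?c s \<in> carrier R" "?d s \<in> carrier R" if "s \<in> F \<union> G" for s
  proof -
    show "s \<in> carrier M" using that F(2) G(2) assms(2) by blast
    show "?c s \<in> carrier R" using PiE[OF cd(1)] that C(1) by blast
    show "?d s \<in> carrier R" using PiE[OF cd(2)] that C(1) by blast
  qed
  have "x \<oplus>\<^bsub>M\<^esub> y = (\<Oplus>\<^bsub>M\<^esub>s\<in>F \<union> G. ?c s \<odot>\<^bsub>M\<^esub> s \<oplus>\<^bsub>M\<^esub> ?d s \<odot>\<^bsub>M\<^esub> s)"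
    unfolding F(4) G(4) ext[of F c, OF Un_upper1 F(3)] ext[of G d, OF Un_upper2 G(3)]
    using mem by (intro M.finsum_addf[symmetric]) blast+
  also have "\<dots> = (\<Oplus>\<^bsub>M\<^esub>s\<in>F \<union> G. (?c s \<oplus> ?d s) \<odot>\<^bsub>M\<^esub> s)"
    using mem by (intro M.finsum_cong' refl funcsetI smult_l_distr[symmetric] smult_closed R.a_closed) blast+
  finally show ?thesis
    using F(1,2) G(1,2) PiE[OF cd(1)] PiE[OF cd(2)]
    by (intro lin_spanI[of "F \<union> G" _ "\<lambda>s. ?c s \<oplus> ?d s"] funcsetI C(7)) blast+
qed

lemma (in module) lin_span_smult:
  assumes "subring C R" "S \<subseteq> carrier M" "r \<in> C" "x \<in> lin_span C M S"
  shows "r \<odot>\<^bsub>M\<^esub> x \<in> lin_span C M S"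
proof -
  note C = subringE[OF assms(1)]
  obtain F c where F: "finite F" "F \<subseteq> S" "c \<in> F \<rightarrow> C" "x = (\<Oplus>\<^bsub>M\<^esub>s\<in>F. c s \<odot>\<^bsub>M\<^esub> s)"
    using assms(4) unfolding lin_span_def by blast
  have mem: "s \<in> carrier M" "c s \<in> carrier R" if "s \<in> F" for s
    using that F(2,3) assms(2) C(1) by blast+
  have r: "r \<in> carrier R"
    using assms(3) C(1) by blast
  have "r \<odot>\<^bsub>M\<^esub> x = (\<Oplus>\<^bsub>M\<^esub>s\<in>F. r \<odot>\<^bsub>M\<^esub> (c s \<odot>\<^bsub>M\<^esub> s))"
    unfolding F(4) using F(1) r mem by (intro finsum_smult_ldistr) auto
  also have "\<dots> = (\<Oplus>\<^bsub>M\<^esub>s\<in>F. (r \<otimes> c s) \<odot>\<^bsub>M\<^esub> s)"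
    using mem r by (intro M.finsum_cong') (auto simp: smult_assoc1)
  finally show ?thesis
    using F(1-3) C(6)[OF assms(3)] by (intro lin_spanI[of F _ "\<lambda>s. r \<otimes> c s"]) auto
qed

lemma (in module) lin_span_zero: "\<zero>\<^bsub>M\<^esub> \<in> lin_span C M S"
  by (intro lin_spanI[of "{}"]) auto

lemma (in module) lin_span_base:
  assumes "subring C R" "S \<subseteq> carrier M"
  shows "S \<subseteq> lin_span C M S"
proof
  fix s assume s: "s \<in> S"
  then have "s \<in> carrier M" using assms by blast
  then show "s \<in> lin_span C M S"
    using s subringE(3)[OF assms(1)] by (intro lin_spanI[of "{s}" _ "\<lambda>_. \<one>"]) auto
qed

text \<open>Replaces inductions over finite sums: later inclusions of a span in a set are proved by
  checking closure of that set. Neither \<open>C\<close> nor \<open>N\<close> has to be given as a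
  library structure, so \<open>N\<close> can be a preimage, an image or a set of multiples.\<close>

lemma (in module) lin_span_minimal:
  assumes "C \<subseteq> carrier R" "N \<subseteq> carrier M" "S \<subseteq> N" "\<zero>\<^bsub>M\<^esub> \<in> N"
    and add: "\<And>x y. x \<in> N \<Longrightarrow> y \<in> N \<Longrightarrow> x \<oplus>\<^bsub>M\<^esub> y \<in> N"
    and smult: "\<And>r x. r \<in> C \<Longrightarrow> x \<in> N \<Longrightarrow> r \<odot>\<^bsub>M\<^esub> x \<in> N"
  shows "lin_span C M S \<subseteq> N"
proof -
  have "(\<Oplus>\<^bsub>M\<^esub>s\<in>F. c s \<odot>\<^bsub>M\<^esub> s) \<in> N" if "finite F" "F \<subseteq> N" "c \<in> F \<rightarrow> C" for F c
    using that
  proof (induction F)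
    case empty
    then show ?case using assms(4) by simp
  next
    case (insert x F)
    have "(\<lambda>s. c s \<odot>\<^bsub>M\<^esub> s) \<in> insert x F \<rightarrow> N"
      using insert.prems smult by blast
    then have "(\<lambda>s. c s \<odot>\<^bsub>M\<^esub> s) \<in> F \<rightarrow> carrier M" "c x \<odot>\<^bsub>M\<^esub> x \<in> carrier M" "c x \<odot>\<^bsub>M\<^esub> x \<in> N"
      using assms(2) by blast+
    with insert show ?case by (simp add: add)
  qed
  then show ?thesis
    using assms(3) unfolding lin_span_def by blast
qed

lemma (in module) lin_span_closed:
  assumes "C \<subseteq> carrier R" "S \<subseteq> carrier M"
  shows "lin_span C M S \<subseteq> carrier M"
  using assms by (intro lin_span_minimal) auto

lemma (in module) lin_span_subset:
  assumes "subring C R" "T \<subseteq> carrier M" "S \<subseteq> lin_span C M T"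
  shows "lin_span C M S \<subseteq> lin_span C M T"
  using assms subringE(1)[OF assms(1)]
  by (intro lin_span_minimal lin_span_closed lin_span_zero lin_span_add lin_span_smult)

lemma (in module) lin_span_coeff_mono:
  assumes "C \<subseteq> D"
  shows "lin_span C M S \<subseteq> lin_span D M S"
  using assms unfolding lin_span_def by blast

text \<open>A finite spanning set that is dependent contains a vector in the span of the others.
  Removing it keeps the span, and the induction on proper subsets ends at an independent
  set.\<close>

lemma (in module) exists_basis_subset:
  assumes "field R" "finite S" "S \<subseteq> carrier M" "lin_span (carrier R) M S = carrier M"
  shows "\<exists>B\<subseteq>S. is_basis R M B"
  using assms(2-4)
proof (induction S rule: finite_psubset_induct)
  case (psubset S)
  interpret R: field R by fact
  note sub = R.carrier_is_subring
  show ?case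
  proof (cases "lin_indep R M S")
    case True
    then show ?thesis using psubset.prems unfolding is_basis_def by blast
  next
    case False
    then obtain F c t where F: "finite F" "F \<subseteq> S" "c \<in> F \<rightarrow> carrier R"
      "(\<Oplus>\<^bsub>M\<^esub>s\<in>F. c s \<odot>\<^bsub>M\<^esub> s) = \<zero>\<^bsub>M\<^esub>" "t \<in> F" "c t \<noteq> \<zero>"
      unfolding lin_indep_def by blast
    have mem: "s \<in> carrier M" "c s \<in> carrier R" if "s \<in> F" for s
      using that F(2,3) psubset.prems(1) by blast+
    let ?T = "S - {t}"
    let ?y = "\<Oplus>\<^bsub>M\<^esub>s\<in>F - {t}. c s \<odot>\<^bsub>M\<^esub> s"
    have y: "?y \<in> lin_span (carrier R) M ?T"
      using F(1-3) by (intro lin_spanI[OF _ _ _ refl]) auto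
    have T: "?T \<subseteq> carrier M" using psubset.prems by blast
    have y_carrier: "?y \<in> carrier M"
      using y lin_span_closed[OF subset_refl T] by blast
    \<comment> \<open>The term at \<open>t\<close> is split off so that the relation can be solved
      for \<open>t\<close>, its coefficient being invertible in the field.\<close>
    have "F = insert t (F - {t})" using F(5) by blast
    then have "(\<Oplus>\<^bsub>M\<^esub>s\<in>insert t (F - {t}). c s \<odot>\<^bsub>M\<^esub> s) = \<zero>\<^bsub>M\<^esub>" using F(4) by metis
    then have sum: "c t \<odot>\<^bsub>M\<^esub> t \<oplus>\<^bsub>M\<^esub> ?y = \<zero>\<^bsub>M\<^esub>"
      using F(1,5) mem by (subst (asm) M.finsum_insert) (auto simp: Pi_iff)
    have inv: "inv c t \<in> carrier R" "inv c t \<otimes> c t = \<one>"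
      using F(5,6) mem R.field_Units by auto
    have "c t \<odot>\<^bsub>M\<^esub> t = \<ominus>\<^bsub>M\<^esub> ?y"
      using sum F(5) mem y_carrier by (simp add: M.minus_equality)
    then have "t = inv c t \<odot>\<^bsub>M\<^esub> (\<ominus>\<^bsub>M\<^esub> ?y)"
      using inv mem[OF F(5)] smult_assoc1[of "inv c t" "c t" t] by simp
    also have "\<dots> = (\<ominus> (inv c t)) \<odot>\<^bsub>M\<^esub> ?y"
      using inv y_carrier by (simp add: smult_l_minus smult_r_minus)
    finally have t: "t \<in> lin_span (carrier R) M ?T"
      using lin_span_smult[OF sub T _ y, of "\<ominus> (inv c t)"] inv(1) by simp
    then have "S \<subseteq> lin_span (carrier R) M ?T"
      using lin_span_base[OF sub T] by blast
    then have span: "lin_span (carrier R) M ?T = carrier M"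
      using lin_span_subset[OF sub T] lin_span_closed[OF subset_refl T] psubset.prems(2) by blast
    have "?T \<subset> S" using F(2,5) by blast
    from psubset.IH[OF this T span] obtain B where "B \<subseteq> ?T" "is_basis R M B" by (elim exE conjE)
    then show ?thesis by (intro exI[of _ B]) auto
  qed
qed

section \<open>Left ideals and the Jacobson radical\<close>

context ring
begin

section \<open>Left ideals and the existence of maximal ones\<close>

lemma left_idealI:
  assumes "I \<subseteq> carrier R" "\<zero> \<in> I"
    and add: "\<And>x y. x \<in> I \<Longrightarrow> y \<in> I \<Longrightarrow> x \<oplus> y \<in> I"
    and mult: "\<And>a x. a \<in> carrier R \<Longrightarrow> x \<in> I \<Longrightarrow> a \<otimes> x \<in> I"
  shows "left_ideal I R"
proof -
  \<comment> \<open>Closure under negation comes from left multiplication by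
    \<open>\<ominus> \<one>\<close>.\<close>
  have "\<ominus> x \<in> I" if "x \<in> I" for x
    using mult[of "\<ominus> \<one>" x] that assms(1) by (auto simp: l_minus)
  then have "subgroup I (add_monoid R)"
    using assms(1,2) add by (intro add.subgroupI) auto
  then show ?thesis
    unfolding left_ideal_def using mult by (auto intro: additive_subgroupI)
qed

lemma left_idealE:
  assumes "left_ideal I R"
  shows "I \<subseteq> carrier R" "\<zero> \<in> I"
    and "\<And>x y. x \<in> I \<Longrightarrow> y \<in> I \<Longrightarrow> x \<oplus> y \<in> I"
    and "\<And>a x. a \<in> carrier R \<Longrightarrow> x \<in> I \<Longrightarrow> a \<otimes> x \<in> I"
proof -
  interpret additive_subgroup I R using assms unfolding left_ideal_def by blast
  show "I \<subseteq> carrier R" "\<zero> \<in> I"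
    and "\<And>x y. x \<in> I \<Longrightarrow> y \<in> I \<Longrightarrow> x \<oplus> y \<in> I"
    using a_subset by auto
  show "\<And>a x. a \<in> carrier R \<Longrightarrow> x \<in> I \<Longrightarrow> a \<otimes> x \<in> I"
    using assms unfolding left_ideal_def by blast
qed

lemma left_ideal_eq_carrier_iff:
  assumes "left_ideal I R"
  shows "I = carrier R \<longleftrightarrow> \<one> \<in> I"
proof
  assume "\<one> \<in> I"
  then have "a \<in> I" if "a \<in> carrier R" for a
    using left_idealE(4)[OF assms that, of \<one>] that by simp
  then show "I = carrier R" using left_idealE(1)[OF assms] by blast
qed simp

text \<open>Zorn's lemma for the left ideals that contain \<open>I\<close> and omit
  \<open>\<one>\<close>. Properness is phrased as the absence of \<open>\<one>\<close> because in
  this form it visibly survives unions of chains.\<close>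

lemma exists_maximal_left_ideal:
  assumes "left_ideal I R" "\<one> \<notin> I"
  shows "\<exists>N. maximal_left_ideal N R \<and> I \<subseteq> N"
proof -
  define \<A> where "\<A> = {J. left_ideal J R \<and> I \<subseteq> J \<and> \<one> \<notin> J}"
  have "\<exists>N\<in>\<A>. \<forall>P\<in>\<A>. N \<subseteq> P \<longrightarrow> P = N"
  proof (rule subset_Zorn_nonempty)
    show "\<A> \<noteq> {}" using assms unfolding \<A>_def by blast
    fix \<C> assume \<C>: "\<C> \<noteq> {}" "subset.chain \<A> \<C>"
    then have sub: "\<C> \<subseteq> \<A>" and chain: "\<And>P Q. P \<in> \<C> \<Longrightarrow> Q \<in> \<C> \<Longrightarrow> P \<subseteq> Q \<or> Q \<subseteq> P"
      by (auto simp: subset_chain_def)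
    have li: "left_ideal P R" if "P \<in> \<C>" for P
      using that sub unfolding \<A>_def by blast
    have "left_ideal (\<Union>\<C>) R"
    proof (rule left_idealI)
      show "\<Union>\<C> \<subseteq> carrier R" using left_idealE(1)[OF li] by (rule Union_least)
      show "\<zero> \<in> \<Union>\<C>" using left_idealE(2)[OF li] \<C>(1) by (meson UnionI all_not_in_conv)
      show "x \<oplus> y \<in> \<Union>\<C>" if xy: "x \<in> \<Union>\<C>" "y \<in> \<Union>\<C>" for x y
      proof -
        obtain P Q where "P \<in> \<C>" "x \<in> P" "Q \<in> \<C>" "y \<in> Q" using xy by blast
        then show ?thesis
          using chain[of P Q] left_idealE(3)[OF li, of P x y] left_idealE(3)[OF li, of Q x y]
          by (meson UnionI subsetD)
      qed
      show "a \<otimes> x \<in> \<Union>\<C>" if "a \<in> carrier R" "x \<in> \<Union>\<C>" for a x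
        using that left_idealE(4)[OF li] by (meson UnionE UnionI)
    qed
    moreover have "I \<subseteq> \<Union>\<C>" "\<one> \<notin> \<Union>\<C>" using sub \<C>(1) unfolding \<A>_def by auto
    ultimately show "\<Union>\<C> \<in> \<A>" unfolding \<A>_def by simp
  qed
  then obtain N where N: "left_ideal N R" "I \<subseteq> N" "\<one> \<notin> N"
    and max: "\<And>P. P \<in> \<A> \<Longrightarrow> N \<subseteq> P \<Longrightarrow> P = N"
    unfolding \<A>_def by auto
  have "J = N \<or> J = carrier R" if J: "left_ideal J R" "N \<subseteq> J" for J
  proof (cases "\<one> \<in> J")
    case True
    then show ?thesis using left_ideal_eq_carrier_iff[OF J(1)] by simp
  next
    case False
    then have "J \<in> \<A>" using J N(2) unfolding \<A>_def by simp
    then show ?thesis using max J(2) by simp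
  qed
  then have "maximal_left_ideal N R"
    using N left_ideal_eq_carrier_iff[OF N(1)] unfolding maximal_left_ideal_def by simp
  then show ?thesis using N by blast
qed

section \<open>The Jacobson radical as a two-sided ideal\<close>

lemma left_ideal_jacobson_radical: "left_ideal (jacobson_radical R) R"
proof (rule left_idealI)
  have *: "left_ideal I R" if "maximal_left_ideal I R" for I
    using that unfolding maximal_left_ideal_def by blast
  show "jacobson_radical R \<subseteq> carrier R" unfolding jacobson_radical_def by blast
  show "\<zero> \<in> jacobson_radical R"
    using left_idealE(2)[OF *] unfolding jacobson_radical_def by simp
  show "x \<oplus> y \<in> jacobson_radical R"
    if "x \<in> jacobson_radical R" "y \<in> jacobson_radical R" for x y
    using that left_idealE(3)[OF *] unfolding jacobson_radical_def by simp
  show "a \<otimes> x \<in> jacobson_radical R"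
    if "a \<in> carrier R" "x \<in> jacobson_radical R" for a x
    using that left_idealE(4)[OF *] unfolding jacobson_radical_def by simp
qed

text \<open>If \<open>\<one>\<close> were not a left multiple of \<open>\<one> \<ominus> x\<close>,
  these multiples would lie in a maximal left ideal. That ideal also contains \<open>x\<close>,
  hence \<open>\<one>\<close>, a contradiction.\<close>

lemma one_minus_jacobson_left_invertible:
  assumes "x \<in> jacobson_radical R"
  shows "\<exists>u\<in>carrier R. u \<otimes> (\<one> \<ominus> x) = \<one>"
proof (rule ccontr)
  assume neg: "\<not> ?thesis"
  have x: "x \<in> carrier R" using assms unfolding jacobson_radical_def by blast
  define I where "I = (\<lambda>u. u \<otimes> (\<one> \<ominus> x)) ` carrier R"
  have "left_ideal I R"
  proof (rule left_idealI)
    show "\<zero> \<in> I" unfolding I_def using x by (intro image_eqI[of _ _ \<zero>]) auto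
    show "I \<subseteq> carrier R" unfolding I_def using x by auto
    show "y \<oplus> z \<in> I" if yz: "y \<in> I" "z \<in> I" for y z
    proof -
      obtain u v where "u \<in> carrier R" "v \<in> carrier R"
        "y = u \<otimes> (\<one> \<ominus> x)" "z = v \<otimes> (\<one> \<ominus> x)"
        using yz unfolding I_def by blast
      then show ?thesis unfolding I_def using x
        by (intro image_eqI[of _ _ "u \<oplus> v"]) (auto simp: l_distr)
    qed
    show "a \<otimes> y \<in> I" if a: "a \<in> carrier R" "y \<in> I" for a y
    proof -
      obtain u where "u \<in> carrier R" "y = u \<otimes> (\<one> \<ominus> x)"
        using a unfolding I_def by blast
      then show ?thesis unfolding I_def using x a
        by (intro image_eqI[of _ _ "a \<otimes> u"]) (auto simp: m_assoc)
    qed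
  qed
  moreover have "\<one> \<notin> I" using neg unfolding I_def by force
  ultimately obtain N where N: "maximal_left_ideal N R" "I \<subseteq> N"
    using exists_maximal_left_ideal by blast
  have li: "left_ideal N R" using N unfolding maximal_left_ideal_def by blast
  have "\<one> \<ominus> x \<in> I" unfolding I_def using x by (intro image_eqI[of _ _ \<one>]) auto
  moreover have "x \<in> N" using assms N unfolding jacobson_radical_def by blast
  ultimately have "(\<one> \<ominus> x) \<oplus> x \<in> N" using left_idealE(3)[OF li] N by blast
  moreover have "(\<one> \<ominus> x) \<oplus> x = \<one>" using x by algebra
  ultimately show False
    using left_ideal_eq_carrier_iff[OF li] N(1) unfolding maximal_left_ideal_def by simp
qed

text \<open>Right multiplication by \<open>a\<close> induces an embedding of the quotient by the transporter of \<open>I\<close>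
  into the simple module \<open>R/I\<close>.\<close>

lemma maximal_left_ideal_transporter:
  assumes "maximal_left_ideal I R" "a \<in> carrier R" "a \<notin> I"
  shows "maximal_left_ideal {x \<in> carrier R. x \<otimes> a \<in> I} R"
    (is "maximal_left_ideal ?T R")
proof -
  have I: "left_ideal I R" and max: "\<And>J. left_ideal J R \<Longrightarrow> I \<subseteq> J \<Longrightarrow> J = I \<or> J = carrier R"
    using assms unfolding maximal_left_ideal_def by simp_all
  note IE = left_idealE[OF I]
  have T: "left_ideal ?T R"
    using IE assms(2) by (intro left_idealI) (auto simp: l_distr m_assoc)
  have "N = carrier R" if N: "left_ideal N R" "?T \<subseteq> N" "N \<noteq> ?T" for N
  proof -
    note NE = left_idealE[OF N(1)]
    obtain y where y: "y \<in> N" "y \<otimes> a \<notin> I"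
    proof -
      obtain y where "y \<in> N" "y \<notin> ?T" using N(2,3) by blast
      then show ?thesis using NE(1) by (intro that[of y]) auto
    qed
    have yc: "y \<in> carrier R" using y(1) NE(1) by blast
    \<comment> \<open>This is \<open>I\<close> plus the left ideal generated by
      \<open>y \<otimes> a\<close>. It properly contains \<open>I\<close>, so maximality of
      \<open>I\<close> makes it the whole ring.\<close>
    define J where "J = {i \<oplus> w \<otimes> (y \<otimes> a) | i w. i \<in> I \<and> w \<in> carrier R}"
    have "left_ideal J R"
    proof (rule left_idealI)
      show "J \<subseteq> carrier R" unfolding J_def using IE(1) assms(2) yc by auto
      show "\<zero> \<in> J" unfolding J_def using IE(2) assms(2) yc
        by (auto intro!: exI[of _ \<zero>])
      show "p \<oplus> q \<in> J" if pq: "p \<in> J" "q \<in> J" for p q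
      proof -
        obtain i w j v where *: "i \<in> I" "w \<in> carrier R" "j \<in> I" "v \<in> carrier R"
          "p = i \<oplus> w \<otimes> (y \<otimes> a)" "q = j \<oplus> v \<otimes> (y \<otimes> a)"
          using pq unfolding J_def by blast
        have "i \<in> carrier R" "j \<in> carrier R" using * IE(1) by auto
        then have "p \<oplus> q = (i \<oplus> j) \<oplus> (w \<oplus> v) \<otimes> (y \<otimes> a)"
          unfolding * using *(2,4) assms(2) yc by algebra
        then show ?thesis unfolding J_def using IE(3)[OF *(1,3)] *(2,4) by blast
      qed
      show "b \<otimes> p \<in> J" if bp: "b \<in> carrier R" "p \<in> J" for b p
      proof -
        obtain i w where *: "i \<in> I" "w \<in> carrier R" "p = i \<oplus> w \<otimes> (y \<otimes> a)"
          using bp unfolding J_def by blast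
        have "i \<in> carrier R" using * IE(1) by auto
        then have "b \<otimes> p = (b \<otimes> i) \<oplus> (b \<otimes> w) \<otimes> (y \<otimes> a)"
          unfolding * using *(2) bp(1) assms(2) yc by algebra
        then show ?thesis unfolding J_def using IE(4)[OF bp(1) *(1)] *(2) bp(1) by blast
      qed
    qed
    moreover have "I \<subseteq> J"
    proof
      fix i assume i: "i \<in> I"
      then have "i = i \<oplus> \<zero> \<otimes> (y \<otimes> a)" using IE(1) assms(2) yc by auto
      then show "i \<in> J" unfolding J_def using i by blast
    qed
    moreover have "y \<otimes> a \<in> J"
    proof -
      have "y \<otimes> a = \<zero> \<oplus> \<one> \<otimes> (y \<otimes> a)" using assms(2) yc by auto
      then show ?thesis unfolding J_def using IE(2) by blast
    qed
    ultimately have J: "J = carrier R" using max[of J] y(2) by blast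
    have "z \<in> N" if z: "z \<in> carrier R" for z
    proof -
      \<comment> \<open>Writing \<open>z \<otimes> a\<close> as an element of \<open>J\<close> shows
        that \<open>z \<ominus> w \<otimes> y\<close> lies in the transporter, hence in
        \<open>N\<close>. Since \<open>y\<close> is in \<open>N\<close>, so is
        \<open>z\<close>.\<close>
      have "z \<otimes> a \<in> J" using J z assms(2) by blast
      then obtain i w where *: "i \<in> I" "w \<in> carrier R" "z \<otimes> a = i \<oplus> w \<otimes> (y \<otimes> a)"
        unfolding J_def by blast
      have i: "i \<in> carrier R" using * IE(1) by auto
      have "(z \<ominus> w \<otimes> y) \<otimes> a = z \<otimes> a \<ominus> w \<otimes> (y \<otimes> a)"
        using z *(2) yc assms(2) by algebra
      also have "\<dots> = i"
        unfolding *(3) using i *(2) yc assms(2) by algebra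
      finally have "z \<ominus> w \<otimes> y \<in> ?T" using *(1,2) z yc by auto
      then have "z \<ominus> w \<otimes> y \<in> N" using N(2) by (rule rev_subsetD)
      then have "(z \<ominus> w \<otimes> y) \<oplus> w \<otimes> y \<in> N"
        using NE(4)[OF *(2) y(1)] by (rule NE(3))
      moreover have "(z \<ominus> w \<otimes> y) \<oplus> w \<otimes> y = z" using z *(2) yc by algebra
      ultimately show ?thesis by simp
    qed
    then show ?thesis using NE(1) by blast
  qed
  moreover have "?T \<noteq> carrier R" using left_ideal_eq_carrier_iff[OF T] assms(2,3) by simp
  ultimately show ?thesis
    using T unfolding maximal_left_ideal_def by (auto simp del: mem_Collect_eq)
qed

text \<open>An intersection of left ideals is only a left ideal at first sight. For closure under
  right multiplication by \<open>a\<close>, let \<open>I\<close> be a maximal left ideal not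
  containing \<open>a\<close>: its transporter along \<open>a\<close> is again maximal, so it
  contains the radical.\<close>

lemma ideal_jacobson_radical: "ideal (jacobson_radical R) R"
proof (rule idealI)
  note J = left_ideal_jacobson_radical
  show "ring R" by (rule ring_axioms)
  show "subgroup (jacobson_radical R) (add_monoid R)"
    using J unfolding left_ideal_def by (intro additive_subgroup.a_subgroup) (rule conjunct1)
  fix x a assume x: "x \<in> jacobson_radical R" and a: "a \<in> carrier R"
  show "a \<otimes> x \<in> jacobson_radical R" using left_idealE(4)[OF J a x] .
  have xc: "x \<in> carrier R" using x left_idealE(1)[OF J] by blast
  have "x \<otimes> a \<in> I" if I: "maximal_left_ideal I R" for I
  proof (cases "a \<in> I")
    case True
    moreover have "left_ideal I R" using I unfolding maximal_left_ideal_def by (rule conjunct1)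
    ultimately show ?thesis using left_idealE(4) xc by simp
  next
    case False
    then show ?thesis
      using maximal_left_ideal_transporter[OF I a] x unfolding jacobson_radical_def by blast
  qed
  then show "x \<otimes> a \<in> jacobson_radical R" using xc a unfolding jacobson_radical_def by blast
qed

end

section \<open>Finite-dimensional algebras\<close>

context fd_algebra
begin

interpretation A: ring A by (rule ring_A)
interpretation K: field K by (rule field_K)
interpretation V: module K A by (rule module_A)

section \<open>The scalars as a subring of the algebra, and bounds on independent lists\<close>

lemma one_smult_mult:
  assumes "k \<in> carrier K" "x \<in> carrier A"
  shows "(k \<odot>\<^bsub>A\<^esub> \<one>\<^bsub>A\<^esub>) \<otimes>\<^bsub>A\<^esub> x = k \<odot>\<^bsub>A\<^esub> x"
  using assms by (simp add: smult_mult_left)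

text \<open>The library's \<open>Span\<close>, \<open>independent\<close> and
  \<open>dimension\<close> refer to a subfield of the ambient ring. The image of this map provides
  one whenever \<open>A\<close> is nonzero.\<close>

lemma ring_hom_scalars: "ring_hom_ring K A (\<lambda>k. k \<odot>\<^bsub>A\<^esub> \<one>\<^bsub>A\<^esub>)"
proof (intro ring_hom_ringI2 K.ring_axioms A.ring_axioms ring_hom_memI)
  fix k l assume kl: "k \<in> carrier K" "l \<in> carrier K"
  then show "(k \<otimes>\<^bsub>K\<^esub> l) \<odot>\<^bsub>A\<^esub> \<one>\<^bsub>A\<^esub> = (k \<odot>\<^bsub>A\<^esub> \<one>\<^bsub>A\<^esub>) \<otimes>\<^bsub>A\<^esub> (l \<odot>\<^bsub>A\<^esub> \<one>\<^bsub>A\<^esub>)"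
    by (simp add: one_smult_mult V.smult_assoc1)
qed (auto simp: V.smult_l_distr)

lemma bounded_independent:
  assumes "\<one>\<^bsub>A\<^esub> \<noteq> \<zero>\<^bsub>A\<^esub>"
  shows "\<exists>n. \<forall>Us. A.independent ((\<lambda>k. k \<odot>\<^bsub>A\<^esub> \<one>\<^bsub>A\<^esub>) ` carrier K) Us \<longrightarrow> length Us \<le> n"
proof -
  let ?F = "(\<lambda>k. k \<odot>\<^bsub>A\<^esub> \<one>\<^bsub>A\<^esub>) ` carrier K"
  have F: "subfield ?F A"
    using ring_hom_ring.img_is_subfield(2)[OF ring_hom_scalars K.carrier_is_subfield] assms by simp
  obtain B where B: "finite B" "is_basis K A B" using finite_dim by blast
  obtain Us where Us: "set Us = B" using finite_list[OF B(1)] by blast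
  have sub: "set Us \<subseteq> carrier A" using B(2) Us unfolding is_basis_def by blast
  note Span = A.Span_subgroup_props[OF F sub]
  have base: "set Us \<subseteq> A.Span ?F Us" by (rule A.Span_base_incl[OF F sub])
  \<comment> \<open>Passage from the span taken in the module to the span taken over the subfield of
    scalars, where the library's dimension theory applies.\<close>
  have "lin_span (carrier K) A B \<subseteq> A.Span ?F Us"
  proof (rule V.lin_span_minimal)
    show "r \<odot>\<^bsub>A\<^esub> x \<in> A.Span ?F Us" if "r \<in> carrier K" "x \<in> A.Span ?F Us" for r x
      using A.Span_smult_closed[OF F sub, of "r \<odot>\<^bsub>A\<^esub> \<one>\<^bsub>A\<^esub>" x] that Span(1) one_smult_mult[of r x]
      by auto
  qed (use Span Us base in auto)
  then have "A.Span ?F Us = carrier A" using B(2) Span(1) unfolding is_basis_def by blast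
  then have "A.finite_dimension ?F (carrier A)"
    using A.Span_finite_dimension[OF F sub] by simp
  then obtain n where n: "A.dimension n ?F (carrier A)" by (rule A.finite_dimensionE')
  show ?thesis
    using A.independent_length_le_dimension[OF F n _ A.independent_in_carrier] by blast
qed

text \<open>The powers of \<open>a\<close> are linearly dependent, so some power lies in the span of finitely many
  higher ones; factoring out \<open>a [^] Suc k\<close> leaves a polynomial in \<open>a\<close>.\<close>

lemma strongly_pi_regular:
  assumes a: "a \<in> carrier A"
  shows "\<exists>k. \<exists>b\<in>carrier A. a [^]\<^bsub>A\<^esub> k = a [^]\<^bsub>A\<^esub> Suc k \<otimes>\<^bsub>A\<^esub> b \<and> a [^]\<^bsub>A\<^esub> k = b \<otimes>\<^bsub>A\<^esub> a [^]\<^bsub>A\<^esub> Suc k"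
proof (cases "\<one>\<^bsub>A\<^esub> = \<zero>\<^bsub>A\<^esub>")
  \<comment> \<open>In the zero algebra the scalars do not form a subfield, so it is treated
    separately.\<close>
  case True
  then have "carrier A = {\<zero>\<^bsub>A\<^esub>}" by (rule A.one_zeroD)
  moreover from this have "a = \<zero>\<^bsub>A\<^esub>" using a by simp
  ultimately show ?thesis using True by (intro exI[of _ 0]) simp
next
  case False
  let ?F = "(\<lambda>k. k \<odot>\<^bsub>A\<^esub> \<one>\<^bsub>A\<^esub>) ` carrier K"
  let ?p = "\<lambda>i::nat. a [^]\<^bsub>A\<^esub> i"
  have F: "subfield ?F A"
    using ring_hom_ring.img_is_subfield(2)[OF ring_hom_scalars K.carrier_is_subfield] False by simp
  obtain n where n: "\<forall>Us. A.independent ?F Us \<longrightarrow> length Us \<le> n"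
    using bounded_independent[OF False] by (rule exE)
  \<comment> \<open>Otherwise no power with exponent at most \<open>n\<close> lies in the span of
    the following ones, and the \<open>n + 1\<close> powers with exponents from 0 to
    \<open>n\<close> are independent, one more than the bound allows.\<close>
  have "\<exists>k\<le>n. ?p k \<in> A.Span ?F (map ?p [Suc k..<Suc n])"
  proof (rule ccontr)
    assume neg: "\<not> ?thesis"
    \<comment> \<open>Downward induction on \<open>k\<close>: it starts from the empty list at
      \<open>k = Suc n\<close> and puts one lower power in front at each step.\<close>
    have "A.independent ?F (map ?p [k..<Suc n])" if "k \<le> Suc n" for k
      using that
    proof (induction k rule: inc_induct)
      case base
      then show ?case by simp
    next
      case (step k)
      then have "[k..<Suc n] = k # [Suc k..<Suc n]" by (simp add: upt_conv_Cons del: upt_Suc)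
      then show ?case using step neg a by (auto intro!: A.li_Cons simp del: upt_Suc)
    qed
    from n[rule_format, OF this[of 0]] show False by simp
  qed
  then obtain k where k: "?p k \<in> A.Span ?F (map ?p [Suc k..<Suc n])" by blast
  define q where "q = ?p (Suc k)"
  have q: "q \<in> carrier A" unfolding q_def using a by simp
  \<comment> \<open>The cofactor \<open>b\<close> is required to commute with \<open>a\<close>, so
    that the factorisation found with \<open>b\<close> on the right can also be written with
    \<open>b\<close> on the left.\<close>
  define E where "E = {q \<otimes>\<^bsub>A\<^esub> b | b. b \<in> carrier A \<and> a \<otimes>\<^bsub>A\<^esub> b = b \<otimes>\<^bsub>A\<^esub> a}"
  have "A.Span ?F (map ?p [Suc k..<Suc n]) \<subseteq> E"
  proof (rule A.Span_min[OF F])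
    show "set (map ?p [Suc k..<Suc n]) \<subseteq> carrier A" using a by auto
    show "subgroup E (add_monoid A)"
    proof (rule A.add.subgroupI)
      show "E \<subseteq> carrier A" unfolding E_def using q by auto
      have "q \<otimes>\<^bsub>A\<^esub> \<one>\<^bsub>A\<^esub> \<in> E"
        unfolding E_def using a q by (intro CollectI exI[of _ "\<one>\<^bsub>A\<^esub>"]) simp
      then show "E \<noteq> {}" by blast
      show "\<ominus>\<^bsub>A\<^esub> x \<in> E" if x: "x \<in> E" for x
      proof -
        obtain b where "b \<in> carrier A" "a \<otimes>\<^bsub>A\<^esub> b = b \<otimes>\<^bsub>A\<^esub> a" "x = q \<otimes>\<^bsub>A\<^esub> b"
          using x unfolding E_def by blast
        then show ?thesis unfolding E_def using a q
          by (intro CollectI exI[of _ "\<ominus>\<^bsub>A\<^esub> b"]) (simp add: A.r_minus A.l_minus)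
      qed
      show "x \<oplus>\<^bsub>A\<^esub> y \<in> E" if xy: "x \<in> E" "y \<in> E" for x y
      proof -
        obtain b c where "b \<in> carrier A" "a \<otimes>\<^bsub>A\<^esub> b = b \<otimes>\<^bsub>A\<^esub> a" "x = q \<otimes>\<^bsub>A\<^esub> b"
          "c \<in> carrier A" "a \<otimes>\<^bsub>A\<^esub> c = c \<otimes>\<^bsub>A\<^esub> a" "y = q \<otimes>\<^bsub>A\<^esub> c"
          using xy unfolding E_def by blast
        then show ?thesis unfolding E_def using a q
          by (intro CollectI exI[of _ "b \<oplus>\<^bsub>A\<^esub> c"]) (simp add: A.r_distr A.l_distr)
      qed
    qed
    show "?F <#>\<^bsub>A\<^esub> set (map ?p [Suc k..<Suc n]) \<subseteq> E"
    proof
      fix x assume "x \<in> ?F <#>\<^bsub>A\<^esub> set (map ?p [Suc k..<Suc n])"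
      then obtain l j where l: "l \<in> carrier K" and j: "Suc k \<le> j"
        and x: "x = (l \<odot>\<^bsub>A\<^esub> \<one>\<^bsub>A\<^esub>) \<otimes>\<^bsub>A\<^esub> ?p j"
        unfolding set_mult_def by (auto simp del: upt_Suc)
      \<comment> \<open>Every exponent \<open>j\<close> in the list is at least
        \<open>Suc k\<close>, so \<open>q\<close> can be factored out; the scalar is then moved to
        the cofactor.\<close>
      have "?p j = q \<otimes>\<^bsub>A\<^esub> ?p (j - Suc k)"
        unfolding q_def using A.nat_pow_mult[OF a, of "Suc k" "j - Suc k"] j
        by (simp only: le_add_diff_inverse)
      then have "x = q \<otimes>\<^bsub>A\<^esub> (l \<odot>\<^bsub>A\<^esub> ?p (j - Suc k))"
        unfolding x using l a q by (simp add: one_smult_mult smult_mult_right del: A.nat_pow_Suc)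
      moreover have "a \<otimes>\<^bsub>A\<^esub> (l \<odot>\<^bsub>A\<^esub> ?p (j - Suc k)) = (l \<odot>\<^bsub>A\<^esub> ?p (j - Suc k)) \<otimes>\<^bsub>A\<^esub> a"
        using l a A.nat_pow_Suc2[OF a, of "j - Suc k"] by (simp add: smult_mult_left smult_mult_right)
      ultimately show "x \<in> E"
        unfolding E_def using l a by (intro CollectI exI[of _ "l \<odot>\<^bsub>A\<^esub> ?p (j - Suc k)"]) simp
    qed
  qed
  then obtain b where b: "b \<in> carrier A" "a \<otimes>\<^bsub>A\<^esub> b = b \<otimes>\<^bsub>A\<^esub> a" "?p k = q \<otimes>\<^bsub>A\<^esub> b"
    using subsetD[OF _ k, of E] unfolding E_def by auto
  have comm: "?p j \<otimes>\<^bsub>A\<^esub> b = b \<otimes>\<^bsub>A\<^esub> ?p j" for j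
  proof (induction j)
    case (Suc j)
    have "?p (Suc j) \<otimes>\<^bsub>A\<^esub> b = ?p j \<otimes>\<^bsub>A\<^esub> (b \<otimes>\<^bsub>A\<^esub> a)"
      using a b(1,2) by (simp add: A.m_assoc)
    also have "\<dots> = (b \<otimes>\<^bsub>A\<^esub> ?p j) \<otimes>\<^bsub>A\<^esub> a"
      using a b(1) Suc by (simp flip: A.m_assoc)
    also have "\<dots> = b \<otimes>\<^bsub>A\<^esub> ?p (Suc j)"
      using a b(1) by (simp add: A.m_assoc)
    finally show ?case .
  qed (use b in simp)
  show ?thesis
    using b(1,3) comm[of "Suc k"] unfolding q_def by (intro exI[of _ k] bexI[of _ b] conjI) simp_all
qed

text \<open>By strong pi-regularity \<open>b\<close> satisfies an equation
  \<open>b^k = b^(k+1) c\<close>. Multiplying by \<open>g^k\<close> on the left cancels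
  \<open>b^k\<close> and leaves \<open>b c = 1\<close>, so the left inverse \<open>g\<close> equals
  the right inverse \<open>c\<close>.\<close>

lemma left_inverse_imp_right_inverse:
  assumes b: "b \<in> carrier A" and g: "g \<in> carrier A" and gb: "g \<otimes>\<^bsub>A\<^esub> b = \<one>\<^bsub>A\<^esub>"
  shows "b \<otimes>\<^bsub>A\<^esub> g = \<one>\<^bsub>A\<^esub>"
proof -
  obtain k c where c: "c \<in> carrier A"
    "b [^]\<^bsub>A\<^esub> (k::nat) = b [^]\<^bsub>A\<^esub> Suc k \<otimes>\<^bsub>A\<^esub> c"
    using strongly_pi_regular[OF b] by blast
  have "g [^]\<^bsub>A\<^esub> j \<otimes>\<^bsub>A\<^esub> b [^]\<^bsub>A\<^esub> j = \<one>\<^bsub>A\<^esub>" for j :: nat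
  proof (induction j)
    case (Suc j)
    have "g [^]\<^bsub>A\<^esub> Suc j \<otimes>\<^bsub>A\<^esub> b [^]\<^bsub>A\<^esub> Suc j
        = g [^]\<^bsub>A\<^esub> j \<otimes>\<^bsub>A\<^esub> (g \<otimes>\<^bsub>A\<^esub> b \<otimes>\<^bsub>A\<^esub> b [^]\<^bsub>A\<^esub> j)"
      unfolding A.nat_pow_Suc2[OF b] A.nat_pow_Suc[of g] using b g
      by (simp add: A.m_assoc del: A.nat_pow_Suc)
    also have "g \<otimes>\<^bsub>A\<^esub> b \<otimes>\<^bsub>A\<^esub> b [^]\<^bsub>A\<^esub> j = b [^]\<^bsub>A\<^esub> j"
      unfolding gb using b by simp
    also note Suc
    finally show ?case .
  qed simp
  then have gk: "g [^]\<^bsub>A\<^esub> k \<otimes>\<^bsub>A\<^esub> b [^]\<^bsub>A\<^esub> k = \<one>\<^bsub>A\<^esub>" .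
  have "\<one>\<^bsub>A\<^esub> = g [^]\<^bsub>A\<^esub> k \<otimes>\<^bsub>A\<^esub> (b [^]\<^bsub>A\<^esub> k \<otimes>\<^bsub>A\<^esub> b \<otimes>\<^bsub>A\<^esub> c)"
    unfolding A.nat_pow_Suc[symmetric] c(2)[symmetric] gk ..
  also have "\<dots> = (g [^]\<^bsub>A\<^esub> k \<otimes>\<^bsub>A\<^esub> b [^]\<^bsub>A\<^esub> k) \<otimes>\<^bsub>A\<^esub> (b \<otimes>\<^bsub>A\<^esub> c)"
    using b g c(1) by (simp add: A.m_assoc)
  finally have bc: "b \<otimes>\<^bsub>A\<^esub> c = \<one>\<^bsub>A\<^esub>" unfolding gk using b c(1) by simp
  have "g = (g \<otimes>\<^bsub>A\<^esub> b) \<otimes>\<^bsub>A\<^esub> c" using b g c(1) bc by (simp add: A.m_assoc)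
  then show ?thesis using gb c(1) bc by simp
qed

text \<open>Strong pi-regularity gives \<open>x^k = b x^(k+1)\<close>, that is,
  \<open>(1 - b x) x^k = 0\<close>. As \<open>b x\<close> is in the radical, \<open>1 - b x\<close>
  has a left inverse, and \<open>x^k\<close> vanishes.\<close>

lemma jacobson_radical_nilpotent:
  assumes x: "x \<in> jacobson_radical A"
  shows "\<exists>k::nat. x [^]\<^bsub>A\<^esub> k = \<zero>\<^bsub>A\<^esub>"
proof -
  note J = A.left_idealE[OF A.left_ideal_jacobson_radical]
  have xc: "x \<in> carrier A" using x J(1) by blast
  obtain k b where b: "b \<in> carrier A"
    "x [^]\<^bsub>A\<^esub> (k::nat) = b \<otimes>\<^bsub>A\<^esub> x [^]\<^bsub>A\<^esub> Suc k"
    using strongly_pi_regular[OF xc] by blast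
  obtain u where u: "u \<in> carrier A" "u \<otimes>\<^bsub>A\<^esub> (\<one>\<^bsub>A\<^esub> \<ominus>\<^bsub>A\<^esub> b \<otimes>\<^bsub>A\<^esub> x) = \<one>\<^bsub>A\<^esub>"
    using A.one_minus_jacobson_left_invertible[OF J(4)[OF b(1) x]] by blast
  define p where "p = x [^]\<^bsub>A\<^esub> k"
  have p: "p \<in> carrier A" unfolding p_def using xc by simp
  \<comment> \<open>\<open>Suc k\<close> factors are regrouped with the extra \<open>x\<close> on
    the left, next to \<open>b\<close>.\<close>
  have "p = b \<otimes>\<^bsub>A\<^esub> (x \<otimes>\<^bsub>A\<^esub> p)"
    unfolding p_def using b(2) A.nat_pow_Suc2[OF xc] by simp
  moreover have "(\<one>\<^bsub>A\<^esub> \<ominus>\<^bsub>A\<^esub> b \<otimes>\<^bsub>A\<^esub> x) \<otimes>\<^bsub>A\<^esub> p = p \<ominus>\<^bsub>A\<^esub> b \<otimes>\<^bsub>A\<^esub> (x \<otimes>\<^bsub>A\<^esub> p)"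
    using b(1) xc p by algebra
  ultimately have "(\<one>\<^bsub>A\<^esub> \<ominus>\<^bsub>A\<^esub> b \<otimes>\<^bsub>A\<^esub> x) \<otimes>\<^bsub>A\<^esub> p = \<zero>\<^bsub>A\<^esub>"
    using p by simp
  then have "u \<otimes>\<^bsub>A\<^esub> (\<one>\<^bsub>A\<^esub> \<ominus>\<^bsub>A\<^esub> b \<otimes>\<^bsub>A\<^esub> x) \<otimes>\<^bsub>A\<^esub> p = \<zero>\<^bsub>A\<^esub>"
    using u(1) b(1) xc p by (simp add: A.m_assoc)
  then have "p = \<zero>\<^bsub>A\<^esub>" using u(2) p by simp
  then show ?thesis unfolding p_def by blast
qed

text \<open>The inverse has to lie in the subring \<open>L\<close> and not merely in
  \<open>A\<close>. It is a partial geometric sum of powers of \<open>x\<close>, hence in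
  \<open>L\<close>, and its product with \<open>1 - x\<close> telescopes to
  \<open>1 - x^k\<close>.\<close>

lemma one_minus_nilpotent_left_inverse:
  assumes L: "subring L A" and x: "x \<in> L" and "x [^]\<^bsub>A\<^esub> (k::nat) = \<zero>\<^bsub>A\<^esub>"
  shows "\<exists>u\<in>L. u \<otimes>\<^bsub>A\<^esub> (\<one>\<^bsub>A\<^esub> \<ominus>\<^bsub>A\<^esub> x) = \<one>\<^bsub>A\<^esub>"
proof -
  note LE = subringE[OF L]
  have xc: "x \<in> carrier A" using x LE(1) by blast
  have "\<exists>u\<in>L. u \<otimes>\<^bsub>A\<^esub> (\<one>\<^bsub>A\<^esub> \<ominus>\<^bsub>A\<^esub> x) = \<one>\<^bsub>A\<^esub> \<ominus>\<^bsub>A\<^esub> x [^]\<^bsub>A\<^esub> j" for j :: nat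
  proof (induction j)
    case 0
    then show ?case using LE(2) xc by (intro bexI[of _ "\<zero>\<^bsub>A\<^esub>"]) (simp_all add: A.minus_eq A.r_neg)
  next
    case (Suc j)
    then obtain u where u: "u \<in> L" "u \<otimes>\<^bsub>A\<^esub> (\<one>\<^bsub>A\<^esub> \<ominus>\<^bsub>A\<^esub> x) = \<one>\<^bsub>A\<^esub> \<ominus>\<^bsub>A\<^esub> x [^]\<^bsub>A\<^esub> j" by blast
    have uc: "u \<in> carrier A" using u LE(1) by blast
    \<comment> \<open>The next summand \<open>p\<close> of the geometric sum contributes
      \<open>p - p x\<close>, which turns \<open>1 - p\<close> into \<open>1 - p x\<close>.\<close>
    define p where "p = x [^]\<^bsub>A\<^esub> j"
    have pc: "p \<in> carrier A" unfolding p_def using xc by simp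
    have "p \<in> L" unfolding p_def
      by (induction j) (use LE(3) LE(6)[OF _ x] in simp_all)
    then have "u \<oplus>\<^bsub>A\<^esub> p \<in> L" using u(1) LE(7) by blast
    moreover have "(u \<oplus>\<^bsub>A\<^esub> p) \<otimes>\<^bsub>A\<^esub> (\<one>\<^bsub>A\<^esub> \<ominus>\<^bsub>A\<^esub> x)
        = u \<otimes>\<^bsub>A\<^esub> (\<one>\<^bsub>A\<^esub> \<ominus>\<^bsub>A\<^esub> x) \<oplus>\<^bsub>A\<^esub> (p \<ominus>\<^bsub>A\<^esub> p \<otimes>\<^bsub>A\<^esub> x)"
      using uc pc xc by (simp add: A.minus_eq A.l_distr A.r_distr[of _ _ p] A.r_minus)
    moreover have "(\<one>\<^bsub>A\<^esub> \<ominus>\<^bsub>A\<^esub> p) \<oplus>\<^bsub>A\<^esub> (p \<ominus>\<^bsub>A\<^esub> p \<otimes>\<^bsub>A\<^esub> x) = \<one>\<^bsub>A\<^esub> \<ominus>\<^bsub>A\<^esub> p \<otimes>\<^bsub>A\<^esub> x"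
      using pc xc by algebra
    ultimately show ?case
      using u(2) by (intro bexI[of _ "u \<oplus>\<^bsub>A\<^esub> p"]) (simp_all add: p_def)
  qed
  from this[of k] show ?thesis
    using assms(3) by (simp add: A.minus_eq)
qed

end

section \<open>The quotient by the radical\<close>

context fd_algebra
begin

interpretation A: ring A by (rule ring_A)
interpretation K: field K by (rule field_K)
interpretation V: module K A by (rule module_A)
interpretation J: ideal "jacobson_radical A" A by (rule A.ideal_jacobson_radical)

section \<open>The projection and the algebra structure of the quotient\<close>

lemma radical_proj_eq_iff:
  assumes "x \<in> carrier A" "y \<in> carrier A"
  shows "radical_proj A x = radical_proj A y \<longleftrightarrow> x \<ominus>\<^bsub>A\<^esub> y \<in> jacobson_radical A"
  unfolding radical_proj_def using A.quotient_eq_iff_same_a_r_cos[OF J.is_ideal assms] by simp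

text \<open>The algebra record extends the factor ring by a scalar multiplication, so the two
  records have different types. Comparing fields lets ring facts pass from one to the other.\<close>

lemma radical_quotient_ring_simps:
  "carrier (radical_quotient A) = carrier (A Quot jacobson_radical A)"
  "monoid.mult (radical_quotient A) = monoid.mult (A Quot jacobson_radical A)"
  "monoid.one (radical_quotient A) = monoid.one (A Quot jacobson_radical A)"
  "ring.zero (radical_quotient A) = ring.zero (A Quot jacobson_radical A)"
  "ring.add (radical_quotient A) = ring.add (A Quot jacobson_radical A)"
  by (simp_all add: radical_quotient_def quotient_algebra_def ring.extend_def module.fields_def)

lemma carrier_radical_quotient: "carrier (radical_quotient A) = radical_proj A ` carrier A"
  by (auto simp: radical_quotient_ring_simps FactRing_simps radical_proj_def)

lemma radical_proj_ring_hom: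
  shows "radical_proj A \<one>\<^bsub>A\<^esub> = \<one>\<^bsub>radical_quotient A\<^esub>"
    and "radical_proj A \<zero>\<^bsub>A\<^esub> = \<zero>\<^bsub>radical_quotient A\<^esub>"
    and "\<And>x y. \<lbrakk>x \<in> carrier A; y \<in> carrier A\<rbrakk> \<Longrightarrow>
      radical_proj A (x \<oplus>\<^bsub>A\<^esub> y) = radical_proj A x \<oplus>\<^bsub>radical_quotient A\<^esub> radical_proj A y"
    and "\<And>x y. \<lbrakk>x \<in> carrier A; y \<in> carrier A\<rbrakk> \<Longrightarrow>
      radical_proj A (x \<otimes>\<^bsub>A\<^esub> y) = radical_proj A x \<otimes>\<^bsub>radical_quotient A\<^esub> radical_proj A y"
proof -
  interpret h: ring_hom_ring A "A Quot jacobson_radical A" "(+>\<^bsub>A\<^esub>) (jacobson_radical A)"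
    by (rule J.rcos_ring_hom_ring)
  show "radical_proj A \<one>\<^bsub>A\<^esub> = \<one>\<^bsub>radical_quotient A\<^esub>"
    "radical_proj A \<zero>\<^bsub>A\<^esub> = \<zero>\<^bsub>radical_quotient A\<^esub>"
    "\<And>x y. \<lbrakk>x \<in> carrier A; y \<in> carrier A\<rbrakk> \<Longrightarrow>
      radical_proj A (x \<oplus>\<^bsub>A\<^esub> y) = radical_proj A x \<oplus>\<^bsub>radical_quotient A\<^esub> radical_proj A y"
    "\<And>x y. \<lbrakk>x \<in> carrier A; y \<in> carrier A\<rbrakk> \<Longrightarrow>
      radical_proj A (x \<otimes>\<^bsub>A\<^esub> y) = radical_proj A x \<otimes>\<^bsub>radical_quotient A\<^esub> radical_proj A y"
    by (simp_all add: radical_proj_def radical_quotient_ring_simps)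
qed

text \<open>The scalar multiple of a coset is a union over its representatives. All the sets in this
  union coincide, because the radical is stable under scalars.\<close>

lemma radical_proj_smult:
  assumes k: "k \<in> carrier K" and a: "a \<in> carrier A"
  shows "radical_proj A (k \<odot>\<^bsub>A\<^esub> a) = k \<odot>\<^bsub>radical_quotient A\<^esub> radical_proj A a"
proof -
  have eq: "radical_proj A (k \<odot>\<^bsub>A\<^esub> x) = radical_proj A (k \<odot>\<^bsub>A\<^esub> a)"
    if x: "x \<in> radical_proj A a" for x
  proof -
    have xc: "x \<in> carrier A"
      using x A.a_r_coset_subset_G[OF J.a_subset a] unfolding radical_proj_def by blast
    have "radical_proj A a = radical_proj A x"
      using J.a_repr_independence'[OF _ a] x unfolding radical_proj_def by blast
    then have "x \<ominus>\<^bsub>A\<^esub> a \<in> jacobson_radical A"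
      using radical_proj_eq_iff[OF xc a] by simp
    \<comment> \<open>The scalar acts as multiplication by \<open>k \<odot> \<one>\<close>, which
      brings the ideal property of the radical into play.\<close>
    then have "(k \<odot>\<^bsub>A\<^esub> \<one>\<^bsub>A\<^esub>) \<otimes>\<^bsub>A\<^esub> (x \<ominus>\<^bsub>A\<^esub> a) \<in> jacobson_radical A"
      using k by (intro J.I_l_closed) auto
    also have "(k \<odot>\<^bsub>A\<^esub> \<one>\<^bsub>A\<^esub>) \<otimes>\<^bsub>A\<^esub> (x \<ominus>\<^bsub>A\<^esub> a) = k \<odot>\<^bsub>A\<^esub> x \<ominus>\<^bsub>A\<^esub> k \<odot>\<^bsub>A\<^esub> a"
      using k a xc
      by (simp add: one_smult_mult A.minus_eq V.smult_r_distr V.smult_r_minus)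
    finally show ?thesis
      using k a xc by (simp add: radical_proj_eq_iff)
  qed
  have a_mem: "a \<in> radical_proj A a"
    unfolding radical_proj_def using J.a_rcos_self[OF a] .
  have "k \<odot>\<^bsub>radical_quotient A\<^esub> radical_proj A a
      = (\<Union>x\<in>radical_proj A a. radical_proj A (k \<odot>\<^bsub>A\<^esub> x))"
    by (simp add: radical_quotient_def quotient_algebra_def ring.extend_def module.fields_def
        radical_proj_def)
  also have "\<dots> = radical_proj A (k \<odot>\<^bsub>A\<^esub> a)"
    by (rule SUP_eqI) (erule equalityD1[OF eq], use a_mem in blast)
  finally show ?thesis by (rule sym)
qed

lemma ring_radical_quotient: "ring (radical_quotient A)"
proof -
  interpret Q: ring "A Quot jacobson_radical A" by (rule J.quotient_is_ring)
  show ?thesis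
  proof (intro ringI abelian_groupI monoidI)
    fix x assume "x \<in> carrier (radical_quotient A)"
    then show "\<exists>y\<in>carrier (radical_quotient A). y \<oplus>\<^bsub>radical_quotient A\<^esub> x = \<zero>\<^bsub>radical_quotient A\<^esub>"
      unfolding radical_quotient_ring_simps
      by (intro bexI[of _ "\<ominus>\<^bsub>A Quot jacobson_radical A\<^esub> x"] Q.l_neg Q.a_inv_closed)
  qed (simp_all add: radical_quotient_ring_simps Q.m_assoc Q.l_distr Q.r_distr Q.a_ac)
qed

text \<open>Every element of the quotient is the projection of an element of \<open>A\<close>, and
  the projection respects all operations, so the axioms are images of those of
  \<open>A\<close>.\<close>

lemma module_radical_quotient: "module K (radical_quotient A)"
proof (intro moduleI K.cring_axioms ring.is_abelian_group[OF ring_radical_quotient])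
qed (auto simp: carrier_radical_quotient V.smult_l_distr V.smult_r_distr V.smult_assoc1
    simp flip: radical_proj_ring_hom radical_proj_smult)

text \<open>Both inclusions follow from minimality of spans, applied to the preimage of the
  right-hand span and to the image of the left-hand one. With \<open>C\<close> equal to
  \<open>R\<close> this transports finite generation, with all of \<open>K\<close> it transports
  bases and fullness.\<close>

lemma radical_proj_lin_span:
  assumes C: "subring C K" and S: "S \<subseteq> carrier A"
  shows "radical_proj A ` lin_span C A S = lin_span C (radical_quotient A) (radical_proj A ` S)"
proof -
  interpret W: module K "radical_quotient A" by (rule module_radical_quotient)
  note CK = subringE(1)[OF C]
  have span: "lin_span C A S \<subseteq> carrier A" by (rule V.lin_span_closed[OF CK S])
  have hS: "radical_proj A ` S \<subseteq> carrier (radical_quotient A)"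
    using S unfolding carrier_radical_quotient by blast
  let ?N = "{x \<in> carrier A. radical_proj A x \<in> lin_span C (radical_quotient A) (radical_proj A ` S)}"
  have "lin_span C A S \<subseteq> ?N"
  proof (rule V.lin_span_minimal[OF CK])
    show "S \<subseteq> ?N" using S W.lin_span_base[OF C hS] by auto
    show "\<zero>\<^bsub>A\<^esub> \<in> ?N" using W.lin_span_zero by (simp add: radical_proj_ring_hom)
    show "x \<oplus>\<^bsub>A\<^esub> y \<in> ?N" if "x \<in> ?N" "y \<in> ?N" for x y
      using that W.lin_span_add[OF C hS] by (simp add: radical_proj_ring_hom)
    show "r \<odot>\<^bsub>A\<^esub> x \<in> ?N" if "r \<in> C" "x \<in> ?N" for r x
      using that W.lin_span_smult[OF C hS] subsetD[OF CK] by (simp add: radical_proj_smult)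
  qed simp
  moreover have "lin_span C (radical_quotient A) (radical_proj A ` S) \<subseteq> radical_proj A ` lin_span C A S"
  proof (rule W.lin_span_minimal[OF CK])
    show "radical_proj A ` lin_span C A S \<subseteq> carrier (radical_quotient A)"
      unfolding carrier_radical_quotient using span by (rule image_mono)
    show "radical_proj A ` S \<subseteq> radical_proj A ` lin_span C A S"
      using V.lin_span_base[OF C S] by (rule image_mono)
    show "\<zero>\<^bsub>radical_quotient A\<^esub> \<in> radical_proj A ` lin_span C A S"
      using V.lin_span_zero unfolding radical_proj_ring_hom(2)[symmetric] by (rule imageI)
    show "x \<oplus>\<^bsub>radical_quotient A\<^esub> y \<in> radical_proj A ` lin_span C A S"
      if xy: "x \<in> radical_proj A ` lin_span C A S" "y \<in> radical_proj A ` lin_span C A S" for x y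
    proof -
      obtain u v where uv: "u \<in> lin_span C A S" "v \<in> lin_span C A S"
        "x = radical_proj A u" "y = radical_proj A v"
        using xy by blast
      then show ?thesis
        using V.lin_span_add[OF C S uv(1,2)] subsetD[OF span]
        by (simp flip: radical_proj_ring_hom)
    qed
    show "r \<odot>\<^bsub>radical_quotient A\<^esub> x \<in> radical_proj A ` lin_span C A S"
      if rx: "r \<in> C" "x \<in> radical_proj A ` lin_span C A S" for r x
    proof -
      obtain u where u: "u \<in> lin_span C A S" "x = radical_proj A u" using rx(2) by blast
      then show ?thesis
        using V.lin_span_smult[OF C S rx(1) u(1)] subsetD[OF span] subsetD[OF CK] rx(1)
        by (simp flip: radical_proj_smult)
    qed
  qed
  ultimately show ?thesis by blast
qed

text \<open>The image of a basis still spans but can become dependent, so a basis is extracted from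
  the image of a spanning set.\<close>

lemma radical_quotient_basis_subset:
  assumes "finite S" "S \<subseteq> carrier A" "lin_span (carrier K) A S = carrier A"
  shows "\<exists>B\<subseteq>radical_proj A ` S. finite B \<and> is_basis K (radical_quotient A) B"
proof -
  interpret W: module K "radical_quotient A" by (rule module_radical_quotient)
  have "\<exists>B\<subseteq>radical_proj A ` S. is_basis K (radical_quotient A) B"
  proof (rule W.exists_basis_subset[OF field_K])
    show "finite (radical_proj A ` S)" using assms(1) by simp
    show "radical_proj A ` S \<subseteq> carrier (radical_quotient A)"
      using assms(2) unfolding carrier_radical_quotient by blast
    show "lin_span (carrier K) (radical_quotient A) (radical_proj A ` S) = carrier (radical_quotient A)"
      using radical_proj_lin_span[OF K.carrier_is_subring assms(2)] assms(3)
      unfolding carrier_radical_quotient by simp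
  qed
  then show ?thesis using assms(1) finite_subset by blast
qed

lemma fd_algebra_radical_quotient: "fd_algebra K (radical_quotient A)"
proof (rule fd_algebra.intro)
  show "field K" by (rule field_K)
  show "ring (radical_quotient A)" by (rule ring_radical_quotient)
  show "module K (radical_quotient A)" by (rule module_radical_quotient)
  obtain B where "finite B" "B \<subseteq> carrier A" "lin_span (carrier K) A B = carrier A"
    using finite_dim unfolding is_basis_def by blast
  then show "\<exists>B. finite B \<and> is_basis K (radical_quotient A) B"
    using radical_quotient_basis_subset by blast
qed (auto simp: carrier_radical_quotient smult_mult_left smult_mult_right
    simp flip: radical_proj_ring_hom radical_proj_smult)

end

text \<open>Generators of \<open>L\<close> over \<open>R\<close> span \<open>A\<close> over
  \<open>K\<close> because \<open>L\<close> contains a basis. One finite set then serves both finite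
  generation and the basis condition for the image of the order.\<close>

lemma (in algebra_order) finite_spanning_set:
  assumes "subring R K"
  shows "\<exists>S. finite S \<and> S \<subseteq> L \<and> L = lin_span R A S \<and> lin_span (carrier K) A S = carrier A"
proof -
  interpret K: field K by (rule field_K)
  interpret V: module K A by (rule module_A)
  obtain S where S: "finite S" "S \<subseteq> L" "L = lin_span R A S"
    using finitely_generated_L by blast
  obtain B where B: "B \<subseteq> L" "lin_span (carrier K) A B = carrier A"
    using contains_basis unfolding is_basis_def by blast
  have Sc: "S \<subseteq> carrier A" using S(2) subringE(1)[OF subring_L] by blast
  have "L \<subseteq> lin_span (carrier K) A S"
    unfolding S(3) using subringE(1)[OF assms] by (rule V.lin_span_coeff_mono)
  then have "B \<subseteq> lin_span (carrier K) A S" using B(1) by (rule order_trans[rotated])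
  from V.lin_span_subset[OF K.carrier_is_subring Sc this]
  have "lin_span (carrier K) A S = carrier A"
    using B(2) V.lin_span_closed[OF subset_refl Sc] by simp
  then show ?thesis using S by blast
qed

text \<open>Gives part (a) at once and turns the hypothesis of part (b) into an equality of two
  images under the projection.\<close>

lemma (in fd_algebra) radical_proj_left_multiples:
  assumes "L \<subseteq> carrier A" "a \<in> carrier A"
  shows "radical_proj A ` left_multiples A L a =
    left_multiples (radical_quotient A) (radical_proj A ` L) (radical_proj A a)"
proof -
  have "left_multiples A L a = (\<lambda>l. l \<otimes>\<^bsub>A\<^esub> a) ` L"
    unfolding left_multiples_def by blast
  moreover have "left_multiples (radical_quotient A) (radical_proj A ` L) (radical_proj A a)
      = (\<lambda>l. radical_proj A l \<otimes>\<^bsub>radical_quotient A\<^esub> radical_proj A a) ` L"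
    unfolding left_multiples_def by blast
  ultimately show ?thesis
    using assms by (simp add: image_image subset_iff flip: radical_proj_ring_hom cong: image_cong_simp)
qed

section \<open>Full lattices\<close>

context full_lattice_in_algebra
begin

interpretation A: ring A by (rule ring_A)
interpretation K: field K by (rule field_K)
interpretation V: module K A by (rule module_A)

lemma lattice_subset_carrier: "M \<subseteq> carrier A"
  using additive_M by (rule additive_subgroup.a_subset)

lemma full_lattice_radical_quotient:
  assumes R: "subring R K"
  shows "full_lattice_in_algebra R K (radical_quotient A) (radical_proj A ` L) (radical_proj A ` M)"
proof (intro full_lattice_in_algebra.intro lattice_in_algebra.intro algebra_order.intro
    fd_algebra_radical_quotient algebra_order_axioms.intro lattice_in_algebra_axioms.intro
    full_lattice_in_algebra_axioms.intro)
  interpret Q: ring "radical_quotient A" by (rule ring_radical_quotient)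
  interpret W: module K "radical_quotient A" by (rule module_radical_quotient)
  interpret h: ring_hom_ring A "radical_quotient A" "radical_proj A"
    by (intro ring_hom_ringI2 ring_hom_memI A.ring_axioms Q.ring_axioms)
      (auto simp: radical_proj_ring_hom carrier_radical_quotient)
  note LE = subringE[OF subring_L] and RE = subringE[OF R]
  note Mc = lattice_subset_carrier
  have hM: "radical_proj A ` M \<subseteq> carrier (radical_quotient A)"
    unfolding carrier_radical_quotient using Mc by (rule image_mono)
  show "subring (radical_proj A ` L) (radical_quotient A)"
    using subring_L by (rule h.img_is_subring)
  obtain S where S: "finite S" "S \<subseteq> L" "L = lin_span R A S" "lin_span (carrier K) A S = carrier A"
    using finite_spanning_set[OF R] by blast
  have Sc: "S \<subseteq> carrier A" using S(2) LE(1) by (rule order_trans)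
  show "\<exists>T. finite T \<and> T \<subseteq> radical_proj A ` L \<and> radical_proj A ` L = lin_span R (radical_quotient A) T"
    using S(1,2) radical_proj_lin_span[OF R Sc, folded S(3)]
    by (intro exI[of _ "radical_proj A ` S"] conjI finite_imageI image_mono)
  show "\<exists>B\<subseteq>radical_proj A ` L. is_basis K (radical_quotient A) B"
    using radical_quotient_basis_subset[OF S(1) Sc S(4)] image_mono[OF S(2), of "radical_proj A"]
    by (meson order_trans)
  show "additive_subgroup (radical_proj A ` M) (radical_quotient A)"
    using additive_M additive_subgroup.a_subgroup additive_subgroupI h.img_is_add_subgroup by metis
  show "l \<otimes>\<^bsub>radical_quotient A\<^esub> x \<in> radical_proj A ` M"
    if lx: "l \<in> radical_proj A ` L" "x \<in> radical_proj A ` M" for l x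
  proof -
    obtain l' x' where "l' \<in> L" "l = radical_proj A l'" "x' \<in> M" "x = radical_proj A x'"
      using lx by blast
    then show ?thesis
      using left_closed_M[of l' x'] LE(1) Mc
      by (auto simp: subset_iff simp flip: radical_proj_ring_hom)
  qed
  obtain T where T: "finite T" "T \<subseteq> M" "M = lin_span R A T"
    using finitely_generated_M by blast
  have Tc: "T \<subseteq> carrier A" using T(2) Mc by (rule order_trans)
  show "\<exists>T. finite T \<and> T \<subseteq> radical_proj A ` M \<and> radical_proj A ` M = lin_span R (radical_quotient A) T"
    using T(1,2) radical_proj_lin_span[OF R Tc, folded T(3)]
    by (intro exI[of _ "radical_proj A ` T"] conjI finite_imageI image_mono)
  show "r = \<zero>\<^bsub>K\<^esub> \<or> x = \<zero>\<^bsub>radical_quotient A\<^esub>"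
    if rx: "r \<in> R" "x \<in> radical_proj A ` M" "r \<odot>\<^bsub>radical_quotient A\<^esub> x = \<zero>\<^bsub>radical_quotient A\<^esub>"
    for r x
  \<comment> \<open>Torsion-freeness is not inherited from \<open>M\<close>, since a product that
    vanishes in the quotient only lies in the radical upstairs. It comes from inverting
    \<open>r\<close> in \<open>K\<close>.\<close>
  proof (rule disj_imp[THEN iffD2], rule impI)
    assume r0: "r \<noteq> \<zero>\<^bsub>K\<^esub>"
    have r: "r \<in> carrier K" using rx(1) RE(1) by blast
    have x: "x \<in> carrier (radical_quotient A)" using rx(2) hM by blast
    have inv: "inv\<^bsub>K\<^esub> r \<in> carrier K" "inv\<^bsub>K\<^esub> r \<otimes>\<^bsub>K\<^esub> r = \<one>\<^bsub>K\<^esub>"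
      using r r0 K.field_Units by auto
    have "x = (inv\<^bsub>K\<^esub> r \<otimes>\<^bsub>K\<^esub> r) \<odot>\<^bsub>radical_quotient A\<^esub> x" using inv(2) x by simp
    also have "\<dots> = \<zero>\<^bsub>radical_quotient A\<^esub>"
      using W.smult_assoc1[OF inv(1) r x] rx(3) inv(1) by simp
    finally show "x = \<zero>\<^bsub>radical_quotient A\<^esub>" .
  qed
  show "lin_span (carrier K) (radical_quotient A) (radical_proj A ` M) = carrier (radical_quotient A)"
    using radical_proj_lin_span[OF K.carrier_is_subring Mc] full_M
    by (simp add: carrier_radical_quotient)
qed

text \<open>Fullness gives \<open>A\<beta> = A\<close>, and one-sided inverses in \<open>A\<close> are two-sided.\<close>

lemma generator_invertible:
  assumes \<beta>: "\<beta> \<in> M" "M = left_multiples A L \<beta>"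
  shows "\<exists>\<gamma>\<in>carrier A. \<gamma> \<otimes>\<^bsub>A\<^esub> \<beta> = \<one>\<^bsub>A\<^esub> \<and> \<beta> \<otimes>\<^bsub>A\<^esub> \<gamma> = \<one>\<^bsub>A\<^esub>"
proof -
  have \<beta>c: "\<beta> \<in> carrier A" using \<beta>(1) lattice_subset_carrier by blast
  let ?N = "(\<lambda>a. a \<otimes>\<^bsub>A\<^esub> \<beta>) ` carrier A"
  \<comment> \<open>The left multiples of \<open>\<beta>\<close> by elements of \<open>A\<close>
    form a \<open>K\<close>-subspace containing \<open>M\<close>.\<close>
  have "lin_span (carrier K) A M \<subseteq> ?N"
  proof (rule V.lin_span_minimal)
    show "?N \<subseteq> carrier A" using \<beta>c by auto
    show "M \<subseteq> ?N"
      using subringE(1)[OF subring_L] unfolding \<beta>(2) left_multiples_def by blast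
    show "\<zero>\<^bsub>A\<^esub> \<in> ?N" using \<beta>c by (intro image_eqI[of _ _ "\<zero>\<^bsub>A\<^esub>"]) auto
    show "x \<oplus>\<^bsub>A\<^esub> y \<in> ?N" if xy: "x \<in> ?N" "y \<in> ?N" for x y
    proof -
      obtain a b where "a \<in> carrier A" "x = a \<otimes>\<^bsub>A\<^esub> \<beta>" "b \<in> carrier A" "y = b \<otimes>\<^bsub>A\<^esub> \<beta>"
        using xy by blast
      then show ?thesis
        using \<beta>c by (intro image_eqI[of _ _ "a \<oplus>\<^bsub>A\<^esub> b"]) (auto simp: A.l_distr)
    qed
    show "r \<odot>\<^bsub>A\<^esub> x \<in> ?N" if rx: "r \<in> carrier K" "x \<in> ?N" for r x
    proof -
      obtain a where "a \<in> carrier A" "x = a \<otimes>\<^bsub>A\<^esub> \<beta>"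
        using rx(2) by blast
      then show ?thesis
        using \<beta>c rx(1) by (intro image_eqI[of _ _ "r \<odot>\<^bsub>A\<^esub> a"]) (auto simp: smult_mult_left)
    qed
  qed simp
  then have "\<one>\<^bsub>A\<^esub> \<in> ?N" unfolding full_M using A.one_closed by (rule subsetD)
  then obtain \<gamma> where "\<gamma> \<in> carrier A" "\<one>\<^bsub>A\<^esub> = \<gamma> \<otimes>\<^bsub>A\<^esub> \<beta>" by blast
  then show ?thesis
    using left_inverse_imp_right_inverse[OF \<beta>c] by (intro bexI[of _ \<gamma>]) simp_all
qed

lemma generator_if_radical_proj_generator:
  assumes \<alpha>: "\<alpha> \<in> M" and gen: "radical_proj A ` M = radical_proj A ` left_multiples A L \<alpha>"
    and \<beta>: "\<beta> \<in> M" "M = left_multiples A L \<beta>"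
  shows "M = left_multiples A L \<alpha>"
proof
  note LE = subringE[OF subring_L]
  interpret J: ideal "jacobson_radical A" A by (rule A.ideal_jacobson_radical)
  have \<alpha>c: "\<alpha> \<in> carrier A" and \<beta>c: "\<beta> \<in> carrier A"
    using \<alpha> \<beta>(1) lattice_subset_carrier by blast+
  obtain \<gamma> where \<gamma>: "\<gamma> \<in> carrier A" "\<beta> \<otimes>\<^bsub>A\<^esub> \<gamma> = \<one>\<^bsub>A\<^esub>"
    using generator_invertible[OF \<beta>] by blast
  obtain l where l: "l \<in> L" "\<alpha> = l \<otimes>\<^bsub>A\<^esub> \<beta>"
    using \<alpha> unfolding \<beta>(2) left_multiples_def by blast
  have "radical_proj A \<beta> \<in> radical_proj A ` left_multiples A L \<alpha>"
    using \<beta>(1) unfolding gen[symmetric] by (rule imageI)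
  then obtain m where m: "m \<in> L" "radical_proj A \<beta> = radical_proj A (m \<otimes>\<^bsub>A\<^esub> \<alpha>)"
    unfolding left_multiples_def by blast
  have lc: "l \<in> carrier A" and mc: "m \<in> carrier A" using l(1) m(1) LE(1) by blast+
  define n where "n = \<one>\<^bsub>A\<^esub> \<ominus>\<^bsub>A\<^esub> m \<otimes>\<^bsub>A\<^esub> l"
  \<comment> \<open>Membership in \<open>L\<close> is what later places the inverse of
    \<open>1 - n\<close> in \<open>L\<close>.\<close>
  have nL: "n \<in> L"
    unfolding n_def A.minus_eq using LE(3,5) LE(6)[OF m(1) l(1)] by (intro LE(7))
  have nc: "n \<in> carrier A" using nL LE(1) by blast
  have n_mult: "n \<otimes>\<^bsub>A\<^esub> \<beta> = \<beta> \<ominus>\<^bsub>A\<^esub> m \<otimes>\<^bsub>A\<^esub> \<alpha>"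
    unfolding n_def l(2) using lc mc \<beta>c by (simp add: A.minus_eq A.l_distr A.l_minus A.m_assoc)
  then have "n \<otimes>\<^bsub>A\<^esub> \<beta> \<in> jacobson_radical A"
    using m(2) radical_proj_eq_iff \<alpha>c \<beta>c mc by simp
  \<comment> \<open>Right multiplication by \<open>\<gamma>\<close> removes \<open>\<beta>\<close>;
    this uses that the radical is a two-sided ideal.\<close>
  then have "n \<otimes>\<^bsub>A\<^esub> \<beta> \<otimes>\<^bsub>A\<^esub> \<gamma> \<in> jacobson_radical A"
    using \<gamma>(1) by (rule J.I_r_closed)
  then have "n \<in> jacobson_radical A"
    using \<gamma> \<beta>c nc by (simp add: A.m_assoc)
  then obtain u where u: "u \<in> L" "u \<otimes>\<^bsub>A\<^esub> (\<one>\<^bsub>A\<^esub> \<ominus>\<^bsub>A\<^esub> n) = \<one>\<^bsub>A\<^esub>"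
    using jacobson_radical_nilpotent one_minus_nilpotent_left_inverse[OF subring_L nL] by blast
  have uc: "u \<in> carrier A" using u(1) LE(1) by blast
  have "\<one>\<^bsub>A\<^esub> \<ominus>\<^bsub>A\<^esub> n = m \<otimes>\<^bsub>A\<^esub> l"
    unfolding n_def using mc lc by algebra
  \<comment> \<open>Now \<open>u\<close> is a left inverse of \<open>m l\<close> in
    \<open>L\<close>, and \<open>l \<beta>\<close> is \<open>\<alpha>\<close>, so
    \<open>\<beta>\<close> becomes a left multiple of \<open>\<alpha>\<close> with factor
    \<open>u m\<close> from \<open>L\<close>.\<close>
  then have "\<beta> = u \<otimes>\<^bsub>A\<^esub> (m \<otimes>\<^bsub>A\<^esub> l) \<otimes>\<^bsub>A\<^esub> \<beta>" using u(2) \<beta>c by simp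
  also have "\<dots> = (u \<otimes>\<^bsub>A\<^esub> m) \<otimes>\<^bsub>A\<^esub> \<alpha>"
    unfolding l(2) using uc mc lc \<beta>c by (simp add: A.m_assoc)
  finally have \<beta>_eq: "\<beta> = (u \<otimes>\<^bsub>A\<^esub> m) \<otimes>\<^bsub>A\<^esub> \<alpha>" .
  show "M \<subseteq> left_multiples A L \<alpha>"
  proof
    fix x assume "x \<in> M"
    then obtain p where p: "p \<in> L" "x = p \<otimes>\<^bsub>A\<^esub> \<beta>"
      unfolding \<beta>(2) left_multiples_def by blast
    have "p \<in> carrier A" using p(1) LE(1) by blast
    then have "x = (p \<otimes>\<^bsub>A\<^esub> (u \<otimes>\<^bsub>A\<^esub> m)) \<otimes>\<^bsub>A\<^esub> \<alpha>"
      unfolding p(2) by (subst \<beta>_eq) (use uc mc \<alpha>c in \<open>simp add: A.m_assoc\<close>)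
    then show "x \<in> left_multiples A L \<alpha>"
      unfolding left_multiples_def using LE(6)[OF p(1) LE(6)[OF u(1) m(1)]] by blast
  qed
  show "left_multiples A L \<alpha> \<subseteq> M"
    unfolding left_multiples_def using left_closed_M \<alpha> by blast
qed

end

theorem theorem3p4:
  fixes R :: "'k set" and K :: "('k, 'm) ring_scheme" and A :: "('k, 'a, 'n) module_scheme"
    and L M :: "'a set"
  assumes "noetherian_with_fractions R K"
    and "carrier K \<noteq> R"
    and "fd_algebra K A"
    and "algebra_order R K A L"
    and "full_lattice_in_algebra R K A L M"
  shows "full_lattice_in_algebra R K (radical_quotient A) (radical_proj A ` L) (radical_proj A ` M)
    \<and> (\<forall>\<alpha>\<in>M.
        (M = left_multiples A L \<alpha> \<longrightarrow>
          radical_proj A ` M =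
            left_multiples (radical_quotient A) (radical_proj A ` L) (radical_proj A \<alpha>))
      \<and> (radical_proj A ` M =
            left_multiples (radical_quotient A) (radical_proj A ` L) (radical_proj A \<alpha>) \<longrightarrow>
          M = left_multiples A L \<alpha> \<or> (\<forall>\<beta>\<in>M. M \<noteq> left_multiples A L \<beta>)))"
proof (intro conjI ballI impI)
  have R: "subring R K" using assms(1) by (rule noetherian_with_fractions.subring_R)
  interpret full_lattice_in_algebra R K A L M by fact
  interpret A: ring A by (rule ring_A)
  note LE = subringE[OF subring_L]
  have Mc: "M \<subseteq> carrier A" using additive_M by (rule additive_subgroup.a_subset)
  show "full_lattice_in_algebra R K (radical_quotient A) (radical_proj A ` L) (radical_proj A ` M)"
    using R by (rule full_lattice_radical_quotient)

  fix \<alpha> assume \<alpha>: "\<alpha> \<in> M"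
  note proj_mult = radical_proj_left_multiples[OF LE(1) subsetD[OF Mc \<alpha>]]
  show "radical_proj A ` M =
      left_multiples (radical_quotient A) (radical_proj A ` L) (radical_proj A \<alpha>)"
    if "M = left_multiples A L \<alpha>"
    using that proj_mult by simp
  \<comment> \<open>If the second alternative fails, some \<open>\<beta>\<close> in \<open>M\<close>
    generates \<open>M\<close>, and the preceding lemma yields the first.\<close>
  show "M = left_multiples A L \<alpha> \<or> (\<forall>\<beta>\<in>M. M \<noteq> left_multiples A L \<beta>)"
    if "radical_proj A ` M =
      left_multiples (radical_quotient A) (radical_proj A ` L) (radical_proj A \<alpha>)"
    using generator_if_radical_proj_generator[OF \<alpha>] that proj_mult by auto
qed

end
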